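(* Let $R=k[x,y]$ be a polynomial ring in two variables over a field $k$, and let $G$ be an edge-labeled graph over $R$ all of whose edges are labeled by principal ideals. Suppose there is a cover $\{U_{f_i}\}$ of $\operatorname{Spec}(R)$ by distinguished open sets such that for each $i$ the graph $G_{f_i}$ is trivial or fully determined by cycles. Then $R_G$ is a free $R$-module.
   Context: An edge-labeled graph $G$ over $R$ is a finite graph $(V,E)$ with a map $\alpha$ from $E$ to the set of ideals of $R$. A spline is a function $s:V\to R$ with $s(u)-s(v)\in\alpha(e_{uv})$ for every edge $e_{uv}$ joining $u$ and $v$; the splines form a ring $R_G$ under pointwise operations, which is an $R$-module via constant splines. For $f\in R$, $U_f=D(f)\subseteq\operatorname{Spec}(R)$ is the distinguished (standard) open set, and $G_f$ is the edge-labeled graph over $R_f$ with the same underlying graph and each edge ideal $I$ replaced by $IR_f$. An edge of an edge-labeled graph over a ring $B$ is trivial if its label is the unit ideal $B$; the graph is trivial if all its edges are trivial. The determining subgraphs of an edge-labeled graph are the connected components having at least one edge of the graph obtained by deleting all trivial edges. The graph is fully determined by cycles if each of its determining subgraphs is a cycle (the remaining vertices meet only trivial edges). *)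

theory Defs
  imports
    "HOL-Computational_Algebra.Polynomial"
    "HOL-Algebra.Ideal"
    "HOL-Algebra.RingHom"
    "Jordan_Normal_Form.VS_Connect"
begin

text \<open>The ring \<open>k[x,y] = k[x][y]\<close>.\<close>

abbreviation kxy :: "'k::field poly poly ring" where
  "kxy \<equiv> class_ring"

section \<open>Localization and the prime spectrum\<close>

definition frac_rel :: "('a, 'm) ring_scheme \<Rightarrow> 'a set \<Rightarrow> (('a \<times> 'a) \<times> ('a \<times> 'a)) set" where
  "frac_rel R S = {((a, s), (b, t)). a \<in> carrier R \<and> s \<in> S \<and> b \<in> carrier R \<and> t \<in> S \<and>
     (\<exists>u\<in>S. u \<otimes>\<^bsub>R\<^esub> (a \<otimes>\<^bsub>R\<^esub> t \<ominus>\<^bsub>R\<^esub> b \<otimes>\<^bsub>R\<^esub> s) = \<zero>\<^bsub>R\<^esub>)}"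

definition fraction :: "('a, 'm) ring_scheme \<Rightarrow> 'a set \<Rightarrow> 'a \<Rightarrow> 'a \<Rightarrow> ('a \<times> 'a) set" where
  "fraction R S a s = frac_rel R S `` {(a, s)}"

text \<open>The unions below are the usual way to lift an operation to equivalence classes: all the
  classes being united coincide (see \<open>localization_mult\<close> and \<open>localization_add\<close>).\<close>

definition localization :: "('a, 'm) ring_scheme \<Rightarrow> 'a set \<Rightarrow> ('a \<times> 'a) set ring" where
  "localization R S = \<lparr>
     carrier = (carrier R \<times> S) // frac_rel R S,
     monoid.mult = (\<lambda>X Y. \<Union>(a, s)\<in>X. \<Union>(b, t)\<in>Y. fraction R S (a \<otimes>\<^bsub>R\<^esub> b) (s \<otimes>\<^bsub>R\<^esub> t)),
     one = fraction R S \<one>\<^bsub>R\<^esub> \<one>\<^bsub>R\<^esub>,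
     ring.zero = fraction R S \<zero>\<^bsub>R\<^esub> \<one>\<^bsub>R\<^esub>,
     add = (\<lambda>X Y. \<Union>(a, s)\<in>X. \<Union>(b, t)\<in>Y.
       fraction R S (a \<otimes>\<^bsub>R\<^esub> t \<oplus>\<^bsub>R\<^esub> b \<otimes>\<^bsub>R\<^esub> s) (s \<otimes>\<^bsub>R\<^esub> t))\<rparr>"

definition powers :: "('a, 'm) ring_scheme \<Rightarrow> 'a \<Rightarrow> 'a set" where
  "powers R f = range (\<lambda>n::nat. f [^]\<^bsub>R\<^esub> n)"

abbreviation localization_at :: "('a, 'm) ring_scheme \<Rightarrow> 'a \<Rightarrow> ('a \<times> 'a) set ring" where
  "localization_at R f \<equiv> localization R (powers R f)"

abbreviation to_localization_at :: "('a, 'm) ring_scheme \<Rightarrow> 'a \<Rightarrow> 'a \<Rightarrow> ('a \<times> 'a) set" where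
  "to_localization_at R f a \<equiv> fraction R (powers R f) a \<one>\<^bsub>R\<^esub>"

definition extended_ideal :: "('a, 'm) ring_scheme \<Rightarrow> 'a \<Rightarrow> 'a set \<Rightarrow> ('a \<times> 'a) set set" where
  "extended_ideal R f I = Idl\<^bsub>localization_at R f\<^esub> (to_localization_at R f ` I)"

definition Spec :: "('a, 'm) ring_scheme \<Rightarrow> 'a set set" where
  "Spec R = {P. primeideal P R}"

definition distinguished_open :: "('a, 'm) ring_scheme \<Rightarrow> 'a \<Rightarrow> 'a set set" where
  "distinguished_open R f = {P \<in> Spec R. f \<notin> P}"

section \<open>Edge-labeled graphs and splines\<close>

text \<open>Edges are abstract objects with a set of one or two endpoints, so parallel edges and loops
  are admitted; a simple graph is the case where \<open>ends\<close> is injective on the edges and takes only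
  two-element values.\<close>

record ('v, 'e) ugraph =
  verts :: "'v set"
  edges :: "'e set"
  ends :: "'e \<Rightarrow> 'v set"

record ('v, 'e, 'a) labeled_graph = "('v, 'e) ugraph" +
  label :: "'e \<Rightarrow> 'a set"

definition finite_graph :: "('v, 'e, 'z) ugraph_scheme \<Rightarrow> bool" where
  "finite_graph G \<longleftrightarrow> finite (verts G) \<and> finite (edges G) \<and>
     (\<forall>e\<in>edges G. \<exists>u\<in>verts G. \<exists>v\<in>verts G. ends G e = {u, v})"

definition edge_labeled_graph ::
    "('a, 'm) ring_scheme \<Rightarrow> ('v, 'e, 'a) labeled_graph \<Rightarrow> bool" where
  "edge_labeled_graph R G \<longleftrightarrow> finite_graph G \<and> (\<forall>e\<in>edges G. ideal (label G e) R)"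

definition spline_set ::
    "('a, 'm) ring_scheme \<Rightarrow> ('v, 'e, 'a) labeled_graph \<Rightarrow> ('v \<Rightarrow> 'a) set" where
  "spline_set R G = {s \<in> verts G \<rightarrow>\<^sub>E carrier R.
     \<forall>e\<in>edges G. \<forall>u v. ends G e = {u, v} \<longrightarrow> s u \<ominus>\<^bsub>R\<^esub> s v \<in> label G e}"

definition spline_ring ::
    "('a, 'm) ring_scheme \<Rightarrow> ('v, 'e, 'a) labeled_graph \<Rightarrow> ('a, 'v \<Rightarrow> 'a) module" where
  "spline_ring R G = \<lparr>
     carrier = spline_set R G,
     monoid.mult = (\<lambda>s t. \<lambda>v\<in>verts G. s v \<otimes>\<^bsub>R\<^esub> t v),
     one = (\<lambda>v\<in>verts G. \<one>\<^bsub>R\<^esub>),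
     ring.zero = (\<lambda>v\<in>verts G. \<zero>\<^bsub>R\<^esub>),
     add = (\<lambda>s t. \<lambda>v\<in>verts G. s v \<oplus>\<^bsub>R\<^esub> t v),
     smult = (\<lambda>r s. \<lambda>v\<in>verts G. r \<otimes>\<^bsub>R\<^esub> s v)\<rparr>"

definition localize_graph ::
    "('a, 'm) ring_scheme \<Rightarrow> 'a \<Rightarrow> ('v, 'e, 'a) labeled_graph
      \<Rightarrow> ('v, 'e, ('a \<times> 'a) set) labeled_graph" where
  "localize_graph R f G = \<lparr>verts = verts G, edges = edges G, ends = ends G,
     label = (\<lambda>e. extended_ideal R f (label G e))\<rparr>"

section \<open>Trivial edges, determining subgraphs, cycles\<close>

definition trivial_edge ::
    "('a, 'm) ring_scheme \<Rightarrow> ('v, 'e, 'a) labeled_graph \<Rightarrow> 'e \<Rightarrow> bool" where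
  "trivial_edge B G e \<longleftrightarrow> label G e = carrier B"

definition trivial_graph ::
    "('a, 'm) ring_scheme \<Rightarrow> ('v, 'e, 'a) labeled_graph \<Rightarrow> bool" where
  "trivial_graph B G \<longleftrightarrow> (\<forall>e\<in>edges G. trivial_edge B G e)"

definition delete_trivial_edges ::
    "('a, 'm) ring_scheme \<Rightarrow> ('v, 'e, 'a) labeled_graph \<Rightarrow> ('v, 'e, 'a) labeled_graph" where
  "delete_trivial_edges B G = G\<lparr>edges := {e \<in> edges G. \<not> trivial_edge B G e}\<rparr>"

definition adjacency :: "('v, 'e, 'z) ugraph_scheme \<Rightarrow> ('v \<times> 'v) set" where
  "adjacency G = {(u, v). \<exists>e\<in>edges G. ends G e = {u, v}}"

definition component_of :: "('v, 'e, 'z) ugraph_scheme \<Rightarrow> 'v \<Rightarrow> ('v, 'e, 'z) ugraph_scheme" where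
  "component_of G v =
     (let W = {w \<in> verts G. (v, w) \<in> (adjacency G)\<^sup>*}
      in G\<lparr>verts := W, edges := {e \<in> edges G. ends G e \<subseteq> W}\<rparr>)"

definition components :: "('v, 'e, 'z) ugraph_scheme \<Rightarrow> ('v, 'e, 'z) ugraph_scheme set" where
  "components G = component_of G ` verts G"

definition determining_subgraphs ::
    "('a, 'm) ring_scheme \<Rightarrow> ('v, 'e, 'a) labeled_graph \<Rightarrow> ('v, 'e, 'a) labeled_graph set" where
  "determining_subgraphs B G = {C \<in> components (delete_trivial_edges B G). edges C \<noteq> {}}"

text \<open>A cycle of length \<open>n\<close> runs through distinct vertices and distinct edges; in a simple graph
  distinctness forces \<open>n \<ge> 3\<close>.\<close>

definition is_cycle :: "('v, 'e, 'z) ugraph_scheme \<Rightarrow> bool" where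
  "is_cycle C \<longleftrightarrow> (\<exists>vs es. vs \<noteq> [] \<and> length es = length vs \<and> distinct vs \<and> distinct es \<and>
     verts C = set vs \<and> edges C = set es \<and>
     (\<forall>i<length vs. ends C (es ! i) = {vs ! i, vs ! (Suc i mod length vs)}))"

definition fully_determined_by_cycles ::
    "('a, 'm) ring_scheme \<Rightarrow> ('v, 'e, 'a) labeled_graph \<Rightarrow> bool" where
  "fully_determined_by_cycles B G \<longleftrightarrow> (\<forall>C\<in>determining_subgraphs B G. is_cycle C)"

section \<open>Free modules\<close>

definition free_module :: "('a, 'm) ring_scheme \<Rightarrow> ('a, 'b, 'n) module_scheme \<Rightarrow> bool" where
  "free_module R M \<longleftrightarrow> module R M \<and>
     (\<exists>B \<subseteq> carrier M. \<not> module.lin_dep R M B \<and> LinearCombinations.module.span R M B = carrier M)"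

section \<open>The constructions are well defined\<close>

lemma UN_UN_const:
  assumes "p \<in> X" "q \<in> Y" "\<And>a s b t. (a, s) \<in> X \<Longrightarrow> (b, t) \<in> Y \<Longrightarrow> F a s b t = c"
  shows "(\<Union>(a, s)\<in>X. \<Union>(b, t)\<in>Y. F a s b t) = c"
proof -
  have inner: "(\<Union>(b, t)\<in>Y. F a s b t) = c" if "(a, s) \<in> X" for a s
    by (rule UN_constant_eq[OF assms(2)]) (clarsimp simp: assms(3) that)
  show ?thesis
    by (rule UN_constant_eq[OF assms(1)]) (clarsimp simp: inner)
qed

lemma (in cring) minus_eq_zero_iff:
  assumes "a \<in> carrier R" "b \<in> carrier R"
  shows "a \<ominus> b = \<zero> \<longleftrightarrow> a = b"
proof
  assume "a \<ominus> b = \<zero>"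
  then have "a = \<ominus> (\<ominus> b)"
    unfolding minus_eq by (intro sum_zero_eq_neg) (use assms in simp_all)
  then show "a = b" using assms by simp
next
  assume "a = b"
  then show "a \<ominus> b = \<zero>" using assms by (simp add: minus_eq r_neg)
qed

locale mult_subset = cring R for R (structure) +
  fixes S
  assumes S_sub: "S \<subseteq> carrier R" and S_one: "\<one> \<in> S"
    and S_mult: "s \<in> S \<Longrightarrow> t \<in> S \<Longrightarrow> s \<otimes> t \<in> S"
begin

lemma S_carrier [simp, intro]: "s \<in> S \<Longrightarrow> s \<in> carrier R"
  using S_sub by blast

lemma frac_relI:
  assumes "a \<in> carrier R" "s \<in> S" "b \<in> carrier R" "t \<in> S" "u \<in> S"
    and "u \<otimes> (a \<otimes> t) = u \<otimes> (b \<otimes> s)"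
  shows "((a, s), (b, t)) \<in> frac_rel R S"
proof -
  have "u \<otimes> (a \<otimes> t \<ominus> b \<otimes> s) = \<zero>"
    using assms by (simp add: minus_eq r_distr r_minus r_neg)
  then show ?thesis using assms by (auto simp: frac_rel_def)
qed

lemma frac_relE:
  assumes "((a, s), (b, t)) \<in> frac_rel R S"
  obtains u where "a \<in> carrier R" "s \<in> S" "b \<in> carrier R" "t \<in> S" "u \<in> S"
    and "u \<otimes> (a \<otimes> t) = u \<otimes> (b \<otimes> s)"
proof -
  from assms obtain u where u: "a \<in> carrier R" "s \<in> S" "b \<in> carrier R" "t \<in> S" "u \<in> S"
    and e: "u \<otimes> (a \<otimes> t \<ominus> b \<otimes> s) = \<zero>"
    by (auto simp: frac_rel_def)
  have "u \<otimes> (a \<otimes> t) \<ominus> u \<otimes> (b \<otimes> s) = \<zero>"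
    using e u by (simp add: minus_eq r_distr r_minus)
  then have "u \<otimes> (a \<otimes> t) = u \<otimes> (b \<otimes> s)"
    using u by (simp add: minus_eq_zero_iff)
  then show ?thesis using that u by blast
qed

lemma equiv_frac_rel: "equiv (carrier R \<times> S) (frac_rel R S)"
proof (rule equivI)
  show "frac_rel R S \<subseteq> (carrier R \<times> S) \<times> (carrier R \<times> S)"
    by (auto simp: frac_rel_def)
  show "refl_on (carrier R \<times> S) (frac_rel R S)"
    by (auto simp: refl_on_def intro!: frac_relI[OF _ _ _ _ S_one])
  show "sym (frac_rel R S)"
    by (rule symI) (auto elim!: frac_relE intro: frac_relI[OF _ _ _ _ _ HOL.sym])
  show "trans (frac_rel R S)"
  proof (rule transI)
    fix x y z assume "(x, y) \<in> frac_rel R S" "(y, z) \<in> frac_rel R S"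
    moreover obtain a s b t c r where xyz: "x = (a, s)" "y = (b, t)" "z = (c, r)"
      by (cases x, cases y, cases z)
    ultimately obtain u w where c: "a \<in> carrier R" "s \<in> S" "b \<in> carrier R" "t \<in> S" "u \<in> S"
        "c \<in> carrier R" "r \<in> S" "w \<in> S"
      and e: "u \<otimes> (a \<otimes> t) = u \<otimes> (b \<otimes> s)" "w \<otimes> (b \<otimes> r) = w \<otimes> (c \<otimes> t)"
      by (auto elim!: frac_relE)
    have "(u \<otimes> w \<otimes> t) \<otimes> (a \<otimes> r) = (u \<otimes> (a \<otimes> t)) \<otimes> (w \<otimes> r)"
      using c by (simp add: m_ac)
    also have "\<dots> = (u \<otimes> (b \<otimes> s)) \<otimes> (w \<otimes> r)"
      by (simp only: e)
    also have "\<dots> = (w \<otimes> (b \<otimes> r)) \<otimes> (u \<otimes> s)"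
      using c by (simp add: m_ac)
    also have "\<dots> = (w \<otimes> (c \<otimes> t)) \<otimes> (u \<otimes> s)"
      by (simp only: e)
    also have "\<dots> = (u \<otimes> w \<otimes> t) \<otimes> (c \<otimes> s)"
      using c by (simp add: m_ac)
    finally show "(x, z) \<in> frac_rel R S"
      unfolding xyz using c S_mult by (intro frac_relI[of _ _ _ _ "u \<otimes> w \<otimes> t"]) auto
  qed
qed

lemma fraction_eq_iff:
  assumes "a \<in> carrier R" "s \<in> S" "b \<in> carrier R" "t \<in> S"
  shows "fraction R S a s = fraction R S b t \<longleftrightarrow> ((a, s), (b, t)) \<in> frac_rel R S"
  using assms eq_equiv_class_iff[OF equiv_frac_rel, of "(a, s)" "(b, t)"]
  by (simp add: fraction_def)

lemma fraction_eqI: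
  assumes "a \<in> carrier R" "s \<in> S" "b \<in> carrier R" "t \<in> S" "a \<otimes> t = b \<otimes> s"
  shows "fraction R S a s = fraction R S b t"
  unfolding fraction_eq_iff[OF assms(1-4)] using assms by (intro frac_relI[OF _ _ _ _ S_one]) auto

lemma fraction_closed [simp, intro]:
  "a \<in> carrier R \<Longrightarrow> s \<in> S \<Longrightarrow> fraction R S a s \<in> carrier (localization R S)"
  by (auto simp: localization_def fraction_def intro!: quotientI)

lemma localization_cases:
  assumes "X \<in> carrier (localization R S)"
  obtains a s where "a \<in> carrier R" "s \<in> S" "X = fraction R S a s"
  using assms by (auto simp: localization_def fraction_def elim!: quotientE)

lemma localization_mult:
  assumes "a \<in> carrier R" "s \<in> S" "b \<in> carrier R" "t \<in> S"
  shows "fraction R S a s \<otimes>\<^bsub>localization R S\<^esub> fraction R S b t = fraction R S (a \<otimes> b) (s \<otimes> t)"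
proof -
  have "fraction R S (a' \<otimes> b') (s' \<otimes> t') = fraction R S (a \<otimes> b) (s \<otimes> t)"
    if "((a, s), (a', s')) \<in> frac_rel R S" "((b, t), (b', t')) \<in> frac_rel R S" for a' s' b' t'
  proof -
    from that obtain u w where c: "a' \<in> carrier R" "s' \<in> S" "b' \<in> carrier R" "t' \<in> S"
        "u \<in> S" "w \<in> S"
      and e: "u \<otimes> (a \<otimes> s') = u \<otimes> (a' \<otimes> s)" "w \<otimes> (b \<otimes> t') = w \<otimes> (b' \<otimes> t)"
      by (auto elim!: frac_relE)
    have "(u \<otimes> w) \<otimes> (a' \<otimes> b' \<otimes> (s \<otimes> t)) = (u \<otimes> (a' \<otimes> s)) \<otimes> (w \<otimes> (b' \<otimes> t))"
      using c assms by (simp add: m_ac)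
    also have "\<dots> = (u \<otimes> (a \<otimes> s')) \<otimes> (w \<otimes> (b \<otimes> t'))"
      by (simp only: e)
    also have "\<dots> = (u \<otimes> w) \<otimes> (a \<otimes> b \<otimes> (s' \<otimes> t'))"
      using c assms by (simp add: m_ac)
    finally have "((a' \<otimes> b', s' \<otimes> t'), (a \<otimes> b, s \<otimes> t)) \<in> frac_rel R S"
      by (intro frac_relI[of _ _ _ _ "u \<otimes> w"]) (simp_all add: c assms S_mult)
    then show ?thesis
      by (subst fraction_eq_iff) (simp_all add: c assms S_mult)
  qed
  then have "fraction R S (a' \<otimes> b') (s' \<otimes> t') = fraction R S (a \<otimes> b) (s \<otimes> t)"
    if "(a', s') \<in> fraction R S a s" "(b', t') \<in> fraction R S b t" for a' s' b' t'
    using that by (simp only: fraction_def Image_singleton_iff)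
  moreover have "(a, s) \<in> fraction R S a s" "(b, t) \<in> fraction R S b t"
    using assms by (simp_all add: fraction_def frac_relI[OF _ _ _ _ S_one])
  ultimately show ?thesis
    unfolding localization_def monoid.simps ring.simps by (intro UN_UN_const)
qed

lemma localization_add:
  assumes "a \<in> carrier R" "s \<in> S" "b \<in> carrier R" "t \<in> S"
  shows "fraction R S a s \<oplus>\<^bsub>localization R S\<^esub> fraction R S b t
    = fraction R S (a \<otimes> t \<oplus> b \<otimes> s) (s \<otimes> t)"
proof -
  have "fraction R S (a' \<otimes> t' \<oplus> b' \<otimes> s') (s' \<otimes> t') = fraction R S (a \<otimes> t \<oplus> b \<otimes> s) (s \<otimes> t)"
    if "((a, s), (a', s')) \<in> frac_rel R S" "((b, t), (b', t')) \<in> frac_rel R S" for a' s' b' t'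
  proof -
    from that obtain u w where c: "a' \<in> carrier R" "s' \<in> S" "b' \<in> carrier R" "t' \<in> S"
        "u \<in> S" "w \<in> S"
      and e: "u \<otimes> (a \<otimes> s') = u \<otimes> (a' \<otimes> s)" "w \<otimes> (b \<otimes> t') = w \<otimes> (b' \<otimes> t)"
      by (auto elim!: frac_relE)
    have "(u \<otimes> w) \<otimes> ((a' \<otimes> t' \<oplus> b' \<otimes> s') \<otimes> (s \<otimes> t))
        = (u \<otimes> (a' \<otimes> s)) \<otimes> (w \<otimes> t \<otimes> t') \<oplus> (w \<otimes> (b' \<otimes> t)) \<otimes> (u \<otimes> s \<otimes> s')"
      using c assms by (simp add: l_distr r_distr m_ac)
    also have "\<dots> = (u \<otimes> (a \<otimes> s')) \<otimes> (w \<otimes> t \<otimes> t') \<oplus> (w \<otimes> (b \<otimes> t')) \<otimes> (u \<otimes> s \<otimes> s')"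
      by (simp only: e)
    also have "\<dots> = (u \<otimes> w) \<otimes> ((a \<otimes> t \<oplus> b \<otimes> s) \<otimes> (s' \<otimes> t'))"
      using c assms by (simp add: l_distr r_distr m_ac)
    finally have "((a' \<otimes> t' \<oplus> b' \<otimes> s', s' \<otimes> t'), (a \<otimes> t \<oplus> b \<otimes> s, s \<otimes> t)) \<in> frac_rel R S"
      by (intro frac_relI[of _ _ _ _ "u \<otimes> w"]) (simp_all add: c assms S_mult)
    then show ?thesis
      by (subst fraction_eq_iff) (simp_all add: c assms S_mult)
  qed
  then have "fraction R S (a' \<otimes> t' \<oplus> b' \<otimes> s') (s' \<otimes> t') = fraction R S (a \<otimes> t \<oplus> b \<otimes> s) (s \<otimes> t)"
    if "(a', s') \<in> fraction R S a s" "(b', t') \<in> fraction R S b t" for a' s' b' t'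
    using that by (simp only: fraction_def Image_singleton_iff)
  moreover have "(a, s) \<in> fraction R S a s" "(b, t) \<in> fraction R S b t"
    using assms by (simp_all add: fraction_def frac_relI[OF _ _ _ _ S_one])
  ultimately show ?thesis
    unfolding localization_def monoid.simps ring.simps by (intro UN_UN_const)
qed

lemma localization_one: "\<one>\<^bsub>localization R S\<^esub> = fraction R S \<one> \<one>"
  by (simp add: localization_def)

lemma localization_zero: "\<zero>\<^bsub>localization R S\<^esub> = fraction R S \<zero> \<one>"
  by (simp add: localization_def)

lemmas localization_simps = localization_mult localization_add localization_one localization_zero

lemma cring_localization: "cring (localization R S)"
proof (rule cringI)
  show "abelian_group (localization R S)"
  proof (rule abelian_groupI)
    fix X Y assume "X \<in> carrier (localization R S)" "Y \<in> carrier (localization R S)"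
    then obtain a s b t where c: "a \<in> carrier R" "s \<in> S" "b \<in> carrier R" "t \<in> S"
      and X: "X = fraction R S a s" and Y: "Y = fraction R S b t"
      by (elim localization_cases)
    show "X \<oplus>\<^bsub>localization R S\<^esub> Y \<in> carrier (localization R S)"
      unfolding X Y using c S_mult by (simp add: localization_add)
    show "X \<oplus>\<^bsub>localization R S\<^esub> Y = Y \<oplus>\<^bsub>localization R S\<^esub> X"
      unfolding X Y using c by (simp add: localization_add m_comm a_comm)
    fix Z assume "Z \<in> carrier (localization R S)"
    then obtain d r where d: "d \<in> carrier R" "r \<in> S" and Z: "Z = fraction R S d r"
      by (elim localization_cases)
    have "(a \<otimes> t \<oplus> b \<otimes> s) \<otimes> r \<oplus> d \<otimes> (s \<otimes> t) = a \<otimes> (t \<otimes> r) \<oplus> (b \<otimes> r \<oplus> d \<otimes> t) \<otimes> s"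
      using c d by (simp add: l_distr r_distr m_ac a_ac)
    then show "X \<oplus>\<^bsub>localization R S\<^esub> Y \<oplus>\<^bsub>localization R S\<^esub> Z
        = X \<oplus>\<^bsub>localization R S\<^esub> (Y \<oplus>\<^bsub>localization R S\<^esub> Z)"
      unfolding X Y Z using c d S_mult by (simp add: localization_add m_assoc)
  next
    fix X assume "X \<in> carrier (localization R S)"
    then obtain a s where c: "a \<in> carrier R" "s \<in> S" and X: "X = fraction R S a s"
      by (elim localization_cases)
    show "\<zero>\<^bsub>localization R S\<^esub> \<oplus>\<^bsub>localization R S\<^esub> X = X"
      unfolding X localization_zero using c S_one by (simp add: localization_add)
    have "fraction R S (\<ominus> a) s \<oplus>\<^bsub>localization R S\<^esub> X = fraction R S \<zero> (s \<otimes> s)"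
      unfolding X using c by (simp add: localization_add l_minus l_neg)
    also have "\<dots> = \<zero>\<^bsub>localization R S\<^esub>"
      unfolding localization_zero using c S_mult S_one by (intro fraction_eqI) auto
    finally show "\<exists>Y\<in>carrier (localization R S). Y \<oplus>\<^bsub>localization R S\<^esub> X = \<zero>\<^bsub>localization R S\<^esub>"
      using c by (intro bexI[of _ "fraction R S (\<ominus> a) s"]) auto
  next
    show "\<zero>\<^bsub>localization R S\<^esub> \<in> carrier (localization R S)"
      unfolding localization_zero using S_one by simp
  qed
  show "comm_monoid (localization R S)"
  proof (rule comm_monoidI)
    fix X Y assume "X \<in> carrier (localization R S)" "Y \<in> carrier (localization R S)"
    then obtain a s b t where c: "a \<in> carrier R" "s \<in> S" "b \<in> carrier R" "t \<in> S"
      and X: "X = fraction R S a s" and Y: "Y = fraction R S b t"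
      by (elim localization_cases)
    show "X \<otimes>\<^bsub>localization R S\<^esub> Y \<in> carrier (localization R S)"
      unfolding X Y using c S_mult by (simp add: localization_mult)
    show "X \<otimes>\<^bsub>localization R S\<^esub> Y = Y \<otimes>\<^bsub>localization R S\<^esub> X"
      unfolding X Y using c by (simp add: localization_mult m_comm)
    fix Z assume "Z \<in> carrier (localization R S)"
    then obtain d r where d: "d \<in> carrier R" "r \<in> S" and Z: "Z = fraction R S d r"
      by (elim localization_cases)
    show "X \<otimes>\<^bsub>localization R S\<^esub> Y \<otimes>\<^bsub>localization R S\<^esub> Z
        = X \<otimes>\<^bsub>localization R S\<^esub> (Y \<otimes>\<^bsub>localization R S\<^esub> Z)"
      unfolding X Y Z using c d S_mult by (simp add: localization_mult m_assoc)
  next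
    fix X assume "X \<in> carrier (localization R S)"
    then obtain a s where c: "a \<in> carrier R" "s \<in> S" and X: "X = fraction R S a s"
      by (elim localization_cases)
    show "\<one>\<^bsub>localization R S\<^esub> \<otimes>\<^bsub>localization R S\<^esub> X = X"
      unfolding X localization_one using c S_one by (simp add: localization_mult)
  next
    show "\<one>\<^bsub>localization R S\<^esub> \<in> carrier (localization R S)"
      unfolding localization_one using S_one by simp
  qed
  fix X Y Z
  assume "X \<in> carrier (localization R S)" "Y \<in> carrier (localization R S)"
    "Z \<in> carrier (localization R S)"
  then obtain a s b t d r where c: "a \<in> carrier R" "s \<in> S" "b \<in> carrier R" "t \<in> S"
      "d \<in> carrier R" "r \<in> S"
    and X: "X = fraction R S a s" and Y: "Y = fraction R S b t" and Z: "Z = fraction R S d r"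
    by (elim localization_cases)
  have "((a \<otimes> t \<oplus> b \<otimes> s) \<otimes> d) \<otimes> (s \<otimes> r \<otimes> (t \<otimes> r))
      = (a \<otimes> d \<otimes> (t \<otimes> r) \<oplus> b \<otimes> d \<otimes> (s \<otimes> r)) \<otimes> (s \<otimes> t \<otimes> r)"
    using c by (simp add: l_distr r_distr m_ac)
  then have "fraction R S ((a \<otimes> t \<oplus> b \<otimes> s) \<otimes> d) (s \<otimes> t \<otimes> r)
      = fraction R S (a \<otimes> d \<otimes> (t \<otimes> r) \<oplus> b \<otimes> d \<otimes> (s \<otimes> r)) (s \<otimes> r \<otimes> (t \<otimes> r))"
    using c S_mult by (intro fraction_eqI) simp_all
  then show "(X \<oplus>\<^bsub>localization R S\<^esub> Y) \<otimes>\<^bsub>localization R S\<^esub> Z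
      = X \<otimes>\<^bsub>localization R S\<^esub> Z \<oplus>\<^bsub>localization R S\<^esub> Y \<otimes>\<^bsub>localization R S\<^esub> Z"
    unfolding X Y Z using c S_mult by (simp add: localization_mult localization_add)
qed

lemma ring_hom_localization: "(\<lambda>a. fraction R S a \<one>) \<in> Ring.ring_hom R (localization R S)"
  by (rule ring_hom_memI) (auto simp: localization_simps S_one)

lemma Units_localization:
  assumes "s \<in> S" shows "fraction R S s \<one> \<in> Units (localization R S)"
proof -
  have "fraction R S \<one> s \<otimes>\<^bsub>localization R S\<^esub> fraction R S s \<one> = \<one>\<^bsub>localization R S\<^esub>"
    "fraction R S s \<one> \<otimes>\<^bsub>localization R S\<^esub> fraction R S \<one> s = \<one>\<^bsub>localization R S\<^esub>"
    using assms fraction_eqI[of s s \<one> \<one>] S_one by (simp_all add: localization_simps)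
  then show ?thesis using assms S_one by (auto simp: Units_def)
qed

end

lemma (in cring) mult_subset_powers:
  assumes "f \<in> carrier R" shows "mult_subset R (powers R f)"
proof
  show "powers R f \<subseteq> carrier R" using assms by (auto simp: powers_def)
  show "\<one> \<in> powers R f" by (auto simp: powers_def intro!: image_eqI[of _ _ 0])
  show "s \<otimes> t \<in> powers R f" if "s \<in> powers R f" "t \<in> powers R f" for s t
    using that assms by (auto simp: powers_def nat_pow_mult)
qed

lemma (in cring) edge_labeled_graph_localize:
  assumes "f \<in> carrier R" "edge_labeled_graph R G"
  shows "edge_labeled_graph (localization_at R f) (localize_graph R f G)"
proof -
  interpret S: mult_subset R "powers R f" by (rule mult_subset_powers) fact
  interpret L: cring "localization_at R f" by (rule S.cring_localization)
  have "ideal (extended_ideal R f (label G e)) (localization_at R f)" if "e \<in> edges G" for e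
  proof -
    have "label G e \<subseteq> carrier R"
      using assms that by (auto simp: edge_labeled_graph_def dest: ideal.Icarr)
    then show ?thesis
      unfolding extended_ideal_def using S.S_one by (intro L.genideal_ideal) auto
  qed
  then show ?thesis
    using assms by (simp add: edge_labeled_graph_def finite_graph_def localize_graph_def)
qed

lemma (in cring) algebra_spline_ring:
  assumes G: "edge_labeled_graph R G"
  shows "algebra R (spline_ring R G)"
proof -
  have I: "ideal (label G e) R" if "e \<in> edges G" for e
    using G that by (simp add: edge_labeled_graph_def)
  have vert: "u \<in> verts G" "v \<in> verts G" if "e \<in> edges G" "ends G e = {u, v}" for e u v
    using G that by (auto simp: edge_labeled_graph_def finite_graph_def doubleton_eq_iff)
  have val: "s v \<in> carrier R" if "s \<in> spline_set R G" "v \<in> verts G" for s v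
    using that by (auto simp: spline_set_def)
  have diff: "s u \<ominus> s v \<in> label G e"
    if "s \<in> spline_set R G" "e \<in> edges G" "ends G e = {u, v}" for s e u v
    using that by (auto simp: spline_set_def)
  have const: "(\<lambda>v\<in>verts G. c) \<in> spline_set R G" if "c \<in> carrier R" for c
    using that I vert
    by (auto simp: spline_set_def minus_eq_zero_iff minus_eq r_neg
        intro: additive_subgroup.zero_closed ideal.axioms(1))
  have add: "(\<lambda>v\<in>verts G. s v \<oplus> t v) \<in> spline_set R G"
    if st: "s \<in> spline_set R G" "t \<in> spline_set R G" for s t
  proof -
    have "(s u \<oplus> t u) \<ominus> (s v \<oplus> t v) \<in> label G e" if e: "e \<in> edges G" "ends G e = {u, v}" for e u v
    proof -
      have "(s u \<oplus> t u) \<ominus> (s v \<oplus> t v) = (s u \<ominus> s v) \<oplus> (t u \<ominus> t v)"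
        using val st vert e by (simp add: minus_eq minus_add a_ac)
      then show ?thesis
        using diff[OF st(1) e] diff[OF st(2) e]
          additive_subgroup.a_closed[OF ideal.axioms(1)[OF I[OF e(1)]]] by simp
    qed
    then show ?thesis using st val vert by (auto simp: spline_set_def)
  qed
  have mult: "(\<lambda>v\<in>verts G. s v \<otimes> t v) \<in> spline_set R G"
    if st: "s \<in> spline_set R G" "t \<in> spline_set R G" for s t
  proof -
    have "s u \<otimes> t u \<ominus> s v \<otimes> t v \<in> label G e" if e: "e \<in> edges G" "ends G e = {u, v}" for e u v
    proof -
      interpret J: ideal "label G e" R by (rule I[OF e(1)])
      have c: "s u \<in> carrier R" "s v \<in> carrier R" "t u \<in> carrier R" "t v \<in> carrier R"
        using val st vert e by auto
      have "s u \<otimes> t u \<ominus> s v \<otimes> t v = s u \<otimes> (t u \<ominus> t v) \<oplus> (s u \<ominus> s v) \<otimes> t v"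
        using c by (simp add: minus_eq l_distr r_distr l_minus r_minus a_ac r_neg r_neg1 r_neg2)
      then show ?thesis
        using J.I_l_closed[OF diff[OF st(2) e] c(1)] J.I_r_closed[OF diff[OF st(1) e] c(4)] by simp
    qed
    then show ?thesis using st val vert by (auto simp: spline_set_def)
  qed
  have smult: "(\<lambda>v\<in>verts G. r \<otimes> s v) \<in> spline_set R G"
    if "r \<in> carrier R" "s \<in> spline_set R G" for r s
  proof -
    have "(\<lambda>v\<in>verts G. (\<lambda>v\<in>verts G. r) v \<otimes> s v) \<in> spline_set R G"
      by (rule mult[OF const]) (use that in auto)
    then show ?thesis by (simp cong: restrict_cong)
  qed
  have rid: "(\<lambda>v\<in>verts G. s v) = s" if "s \<in> spline_set R G" for s
    using that by (auto simp: spline_set_def intro: extensional_restrict)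
  have ab: "abelian_group (spline_ring R G)"
  proof (rule abelian_groupI)
    fix s assume s: "s \<in> carrier (spline_ring R G)"
    then have "(\<lambda>v\<in>verts G. (\<ominus> \<one>) \<otimes> s v) \<in> spline_set R G"
      by (intro smult) (auto simp: spline_ring_def)
    moreover have "(\<lambda>v\<in>verts G. (\<ominus> \<one>) \<otimes> s v) \<oplus>\<^bsub>spline_ring R G\<^esub> s = \<zero>\<^bsub>spline_ring R G\<^esub>"
      using s val by (auto simp: spline_ring_def fun_eq_iff restrict_def l_minus l_neg)
    ultimately show "\<exists>t\<in>carrier (spline_ring R G). t \<oplus>\<^bsub>spline_ring R G\<^esub> s = \<zero>\<^bsub>spline_ring R G\<^esub>"
      by (intro bexI) (simp_all add: spline_ring_def)
  qed (simp_all add: spline_ring_def val const add a_ac rid cong: restrict_cong)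
  have cr: "cring (spline_ring R G)"
    by (rule cringI[OF ab], rule comm_monoidI)
      (simp_all add: spline_ring_def val const mult m_ac l_distr r_distr rid cong: restrict_cong)
  show ?thesis
    by (rule algebraI[OF is_cring cr])
      (simp_all add: spline_ring_def val smult m_assoc l_distr r_distr rid cong: restrict_cong)
qed

end

theory Submission
  imports Defs
    "HOL-Computational_Algebra.Polynomial_Factorial"
    "Jordan_Normal_Form.Determinant"
begin

text \<open>
  The splines form a submodule \<open>M\<close> of a finite power of \<open>k[x][y]\<close> that is saturated at every prime
  \<open>p\<close>: if \<open>p \<nmid> g\<close> and \<open>g m \<in> p M\<close>, then \<open>m \<in> p M\<close>. Any such \<open>M\<close> is free, by Seshadri's argument.
  After discarding superfluous coordinates, \<open>M\<close> has full rank. Among the families in \<open>M\<close> with nonzero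
  determinant, take one whose determinant has least degree in \<open>y\<close> and then a leading coefficient of
  least degree in \<open>x\<close>. By Cramer's rule, pseudo-division and minimality, each \<open>w \<in> M\<close> has a nonzero
  multiple \<open>a w\<close> with \<open>a \<in> k[x]\<close> in the span of the family. If the span were not \<open>M\<close>, some \<open>p w\<close>
  with \<open>p \<in> k[x]\<close> irreducible would be a combination of the family whose coefficients are not all
  divisible by \<open>p\<close>. The Euclidean algorithm over \<open>(k[x]/p)[y]\<close> turns this relation into one with a
  single coefficient prime to \<open>p\<close>; saturation then permits dividing a member of the family by \<open>p\<close>,
  which contradicts minimality.
\<close>

section \<open>Determinants of families of functions on a list of coordinates\<close>

definition family_det :: "'v list \<Rightarrow> (nat \<Rightarrow> 'v \<Rightarrow> 'a::comm_ring_1) \<Rightarrow> 'a" where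
  "family_det vs f = det (mat (length vs) (length vs) (\<lambda>(i, j). f i (vs ! j)))"

text \<open>The cofactors along row \<open>i\<close> do not see that row, so they are those of the
  matrix of \<open>f\<close> itself. This makes the linear dependence on the new row
  \<open>w\<close> explicit.\<close>

lemma family_det_laplace:
  assumes "i < length vs"
  shows "family_det vs (f(i := w)) = (\<Sum>j<length vs. w (vs ! j) *
    cofactor (mat (length vs) (length vs) (\<lambda>(i, j). f i (vs ! j))) i j)"
proof -
  let ?n = "length vs"
  let ?A = "mat ?n ?n (\<lambda>(i, j). f i (vs ! j))"
  let ?B = "mat ?n ?n (\<lambda>(k, j). (f(i := w)) k (vs ! j))"
  have "mat_delete ?B i j = mat_delete ?A i j" for j
    by (rule eq_matI) (auto simp: mat_delete_def)
  then have "cofactor ?B i j = cofactor ?A i j" for j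
    by (simp add: cofactor_def)
  then show ?thesis
    unfolding family_det_def using assms
    by (subst laplace_expansion_row[of ?B ?n i]) (auto intro!: sum.cong)
qed

text \<open>By \<open>A * adj A = det A\<close>, row \<open>l\<close> paired with the cofactors of
  row \<open>i\<close> gives \<open>det A\<close> for \<open>l = i\<close> and \<open>0\<close>
  otherwise. The case \<open>h = 1\<close> covers row operations, \<open>h = [:p:]\<close> the
  division of a row by \<open>p\<close>, and \<open>h = 0\<close> linear relations among the
  rows.\<close>

lemma family_det_replace:
  assumes "i < length vs"
    and "\<And>j. j < length vs \<Longrightarrow> h * w (vs ! j) = (\<Sum>l<length vs. g l * f l (vs ! j))"
  shows "h * family_det vs (f(i := w)) = g i * family_det vs f"
proof -
  let ?n = "length vs"
  let ?A = "mat ?n ?n (\<lambda>(i, j). f i (vs ! j))"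
  have A: "?A \<in> carrier_mat ?n ?n" by simp
  have row: "(\<Sum>j<?n. f l (vs ! j) * cofactor ?A i j) = (if l = i then det ?A else 0)"
    if "l < ?n" for l
  proof -
    have "(?A * adj_mat ?A) $$ (l, i) = (\<Sum>j<?n. f l (vs ! j) * cofactor ?A i j)"
      using that assms(1)
      by (simp add: adj_mat_def scalar_prod_def atLeast0LessThan)
    then show ?thesis
      using that assms(1) unfolding adj_mat(2)[OF A] by (auto simp: mult.commute)
  qed
  have "h * family_det vs (f(i := w)) = (\<Sum>j<?n. (h * w (vs ! j)) * cofactor ?A i j)"
    by (simp add: family_det_laplace[OF assms(1)] sum_distrib_left mult.assoc)
  also have "\<dots> = (\<Sum>j<?n. \<Sum>l<?n. g l * (f l (vs ! j) * cofactor ?A i j))"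
    using assms(2) by (simp add: sum_distrib_right mult.assoc)
  also have "\<dots> = (\<Sum>l<?n. g l * (\<Sum>j<?n. f l (vs ! j) * cofactor ?A i j))"
    by (subst sum.swap) (simp add: sum_distrib_left)
  also have "\<dots> = (\<Sum>l<?n. if l = i then g i * det ?A else 0)"
    by (rule sum.cong) (auto simp: row)
  also have "\<dots> = g i * family_det vs f"
    using assms(1) by (simp add: family_det_def)
  finally show ?thesis .
qed

text \<open>This comes from the opposite identity \<open>adj A * A = det A\<close>. The coefficients
  do not depend on \<open>j\<close>, so they express a multiple of \<open>w\<close> by the family in
  all coordinates at once.\<close>

lemma family_det_cramer:
  assumes "j < length vs"
  shows "family_det vs f * w (vs ! j) = (\<Sum>i<length vs. family_det vs (f(i := w)) * f i (vs ! j))"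
proof -
  let ?n = "length vs"
  let ?A = "mat ?n ?n (\<lambda>(i, j). f i (vs ! j))"
  have A: "?A \<in> carrier_mat ?n ?n" by simp
  have col: "(\<Sum>i<?n. cofactor ?A i k * f i (vs ! j)) = (if k = j then det ?A else 0)"
    if "k < ?n" for k
  proof -
    have "(adj_mat ?A * ?A) $$ (k, j) = (\<Sum>i<?n. cofactor ?A i k * f i (vs ! j))"
      using that assms(1)
      by (simp add: adj_mat_def scalar_prod_def atLeast0LessThan)
    then show ?thesis
      using that assms(1) unfolding adj_mat(3)[OF A] by (auto simp: mult.commute)
  qed
  have "(\<Sum>i<?n. family_det vs (f(i := w)) * f i (vs ! j))
      = (\<Sum>i<?n. \<Sum>k<?n. w (vs ! k) * (cofactor ?A i k * f i (vs ! j)))"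
    by (rule sum.cong) (simp_all add: family_det_laplace sum_distrib_right mult.assoc)
  also have "\<dots> = (\<Sum>k<?n. w (vs ! k) * (\<Sum>i<?n. cofactor ?A i k * f i (vs ! j)))"
    by (subst sum.swap) (simp add: sum_distrib_left)
  also have "\<dots> = (\<Sum>k<?n. if k = j then w (vs ! j) * det ?A else 0)"
    by (rule sum.cong) (auto simp: col)
  also have "\<dots> = family_det vs f * w (vs ! j)"
    using assms(1) by (simp add: family_det_def)
  finally show ?thesis by simp
qed

lemma family_det_eq_0_of_relation:
  assumes "i < length vs" and "\<And>j. j < length vs \<Longrightarrow> (\<Sum>l<length vs. g l * f l (vs ! j)) = 0"
  shows "g i * family_det vs f = 0"
  using family_det_replace[OF assms(1), of 0 "\<lambda>_. 0" g f] assms(2) by simp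

lemma family_det_diagonal:
  assumes "distinct vs"
    and "\<And>i j. i < length vs \<Longrightarrow> j < length vs \<Longrightarrow> i \<noteq> j \<Longrightarrow> f i (vs ! j) = 0"
  shows "family_det vs f = (\<Prod>i<length vs. f i (vs ! i))"
proof -
  let ?n = "length vs"
  let ?A = "mat ?n ?n (\<lambda>(i, j). f i (vs ! j))"
  have "upper_triangular ?A"
    using assms(2) by (auto simp: upper_triangular_def)
  then have "det ?A = prod_list (diag_mat ?A)"
    by (intro det_upper_triangular[where n = ?n]) auto
  then show ?thesis
    by (simp add: family_det_def diag_mat_def prod.list_conv_set_nth atLeast0LessThan)
qed

section \<open>Division modulo an irreducible polynomial, and a measure for the descent\<close>

text \<open>The quotient of \<open>b\<close> by \<open>c\<close> exists in the field k[x]/p. A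
  nonzero \<open>e\<close> of least degree in the ideal (c, p) divides both \<open>c\<close> and
  \<open>p\<close>, and is therefore a unit because \<open>p\<close> is irreducible and does not
  divide \<open>c\<close>.\<close>

lemma irreducible_poly_solve_mod:
  fixes p b c :: "'k::field poly"
  assumes "irreducible p" "\<not> p dvd c"
  shows "\<exists>u. p dvd b - u * c"
proof -
  define P where "P e \<longleftrightarrow> e \<noteq> 0 \<and> (\<exists>u t. e = u * c + t * p)" for e
  have "c = 1 * c + 0 * p" by simp
  then have "P c" using assms(2) unfolding P_def by (metis dvd_0_right)
  define e where "e = (ARG_MIN degree e. P e)"
  have e: "P e" and min: "P e' \<Longrightarrow> degree e \<le> degree e'" for e'
    using \<open>P c\<close> unfolding e_def by (auto intro: arg_min_natI arg_min_nat_le)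
  from e obtain u t where "e \<noteq> 0" and ut: "e = u * c + t * p" by (auto simp: P_def)
  have dvd: "e dvd u' * c + t' * p" for u' t'
  proof (rule ccontr)
    let ?x = "u' * c + t' * p"
    assume nd: "\<not> e dvd ?x"
    have "?x mod e = ?x - (?x div e) * e"
      by (simp add: minus_div_mult_eq_mod)
    also have "\<dots> = (u' - (?x div e) * u) * c + (t' - (?x div e) * t) * p"
      by (subst (2) ut) (simp add: algebra_simps)
    finally have "P (?x mod e)"
      using nd unfolding P_def by (metis mod_eq_0_iff_dvd)
    then have "degree e \<le> degree (?x mod e)" by (rule min)
    moreover have "degree (?x mod e) < degree e"
      using nd \<open>e \<noteq> 0\<close> by (intro degree_mod_less') (auto simp: mod_eq_0_iff_dvd)
    ultimately show False by simp
  qed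
  from dvd[of 0 1] dvd[of 1 0] have "e dvd p" "e dvd c" by simp_all
  then have "e dvd 1"
    using assms by (meson dvd_trans irreducibleD')
  then obtain d where "1 = e * d" by (rule dvdE)
  then have "d * (u * c + t * p) = 1"
    by (metis ut mult.commute)
  then have "b = b * (d * (u * c + t * p))"
    by (metis mult_1_right)
  then have "b - (b * d * u) * c = p * (b * d * t)"
    by (simp add: algebra_simps)
  then show ?thesis by (metis dvd_triv_left)
qed

text \<open>The length of the coefficient list is 0 for the zero polynomial and otherwise the degree
  plus one. Unlike the degree, it also drops when a nonzero constant is cancelled.\<close>

lemma length_coeffs_diff_less:
  fixes a b :: "'a::ab_group_add poly"
  assumes "a \<noteq> 0" "degree b \<le> degree a" "coeff b (degree a) = lead_coeff a"
  shows "length (coeffs (a - b)) < length (coeffs a)"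
proof (cases "a - b = 0")
  case False
  have "degree (a - b) \<le> degree a" using assms(2) by (auto intro: degree_diff_le)
  moreover have "degree (a - b) \<noteq> degree a"
    using False assms(3) by (metis coeff_diff eq_iff_diff_eq_0 leading_coeff_0_iff)
  ultimately show ?thesis using False assms(1) by (simp add: length_coeffs_degree)
qed (use assms(1) in \<open>simp add: length_coeffs_degree\<close>)

lemma sum_change_one:
  fixes H H' :: "nat \<Rightarrow> 'a::ab_group_add"
  assumes "i < n" "\<And>l. l < n \<Longrightarrow> l \<noteq> i \<Longrightarrow> H' l = H l"
  shows "sum H' {..<n} = sum H {..<n} + (H' i - H i)"
proof -
  have "sum H' ({..<n} - {i}) = sum H ({..<n} - {i})" using assms by (intro sum.cong) auto
  then show ?thesis
    using assms(1) sum.remove[of "{..<n}" i H] sum.remove[of "{..<n}" i H'] by simp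
qed

lemma sum_change_one_less:
  fixes g :: "nat \<Rightarrow> 'a" and \<mu> :: "'a \<Rightarrow> nat"
  assumes "i < n" "\<mu> x < \<mu> (g i)"
  shows "(\<Sum>l<n. \<mu> ((g(i := x)) l)) < (\<Sum>l<n. \<mu> (g l))"
  using assms by (intro sum_strict_mono_ex1) (auto intro: less_imp_le)

section \<open>Saturated modules of full rank have a basis\<close>

text \<open>\<open>vanishing\<close> and \<open>nondegenerate\<close> say that restriction to
  \<open>vs\<close> embeds \<open>M\<close> with full rank. \<open>divide_mem\<close> says that M/pM
  is torsion-free over k[x,y]/p for every prime \<open>p\<close>.\<close>

locale saturated_module =
  fixes M :: "('v \<Rightarrow> 'k::field poly poly) set" and vs :: "'v list"
  assumes zero_mem: "(\<lambda>v. 0) \<in> M"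
    and add_mem: "m \<in> M \<Longrightarrow> m' \<in> M \<Longrightarrow> (\<lambda>v. m v + m' v) \<in> M"
    and smult_mem: "m \<in> M \<Longrightarrow> (\<lambda>v. c * m v) \<in> M"
    and vanishing: "m \<in> M \<Longrightarrow> (\<And>j. j < length vs \<Longrightarrow> m (vs ! j) = 0) \<Longrightarrow> m v = 0"
    and divide_mem: "prime_elem p \<Longrightarrow> \<not> p dvd g \<Longrightarrow> m \<in> M \<Longrightarrow> m' \<in> M \<Longrightarrow>
      (\<And>v. g * m v = p * m' v) \<Longrightarrow> \<exists>m''\<in>M. \<forall>v. m v = p * m'' v"
    and nondegenerate: "\<exists>f. (\<forall>i<length vs. f i \<in> M) \<and> family_det vs f \<noteq> 0"
begin

definition family :: "(nat \<Rightarrow> 'v \<Rightarrow> 'k poly poly) \<Rightarrow> bool" where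
  "family f \<longleftrightarrow> (\<forall>i<length vs. f i \<in> M)"

definition combination :: "(nat \<Rightarrow> 'v \<Rightarrow> 'k poly poly) \<Rightarrow> ('v \<Rightarrow> 'k poly poly) \<Rightarrow> bool" where
  "combination f w \<longleftrightarrow> (\<exists>g. \<forall>v. w v = (\<Sum>i<length vs. g i * f i v))"

lemma family_upd: "family f \<Longrightarrow> m \<in> M \<Longrightarrow> family (f(i := m))"
  by (simp add: family_def)

lemma diff_mem:
  assumes "m \<in> M" "m' \<in> M"
  shows "(\<lambda>v. m v - m' v) \<in> M"
  using add_mem[OF assms(1) smult_mem[OF assms(2), of "-1"]] by simp

lemma eq_of_eq_on_coordinates:
  assumes "m \<in> M" "m' \<in> M" "\<And>j. j < length vs \<Longrightarrow> m (vs ! j) = m' (vs ! j)"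
  shows "m v = m' v"
  using vanishing[OF diff_mem[OF assms(1,2)], of v] assms(3) by simp

lemma combination_mem:
  assumes "family f"
  shows "(\<lambda>v. \<Sum>i<length vs. g i * f i v) \<in> M"
proof -
  have "(\<lambda>v. \<Sum>i<k. g i * f i v) \<in> M" if "k \<le> length vs" for k
    using that
  proof (induction k)
    case (Suc k)
    then show ?case
      using add_mem[OF Suc.IH smult_mem[of "f k" "g k"]] assms by (simp add: family_def)
  qed (simp add: zero_mem)
  then show ?thesis by simp
qed

text \<open>Each reduction shortens one coefficient of the relation, absorbing multiples of
  \<open>p\<close> into \<open>w\<close> and multiples of other coefficients into the family by a
  row operation. The index \<open>r\<close> of a coefficient prime to \<open>p\<close> may change on
  the way, hence the induction is general in it.\<close>

lemma divide_family_det: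
  assumes irr: "irreducible p"
    and "family f" "w \<in> M" "\<And>v. [:p:] * w v = (\<Sum>i<length vs. g i * f i v)"
    and "r < length vs" "\<not> [:p:] dvd g r"
  shows "\<exists>f'. family f' \<and> [:p:] * family_det vs f' = family_det vs f"
  using assms(2-)
proof (induction "\<Sum>i<length vs. length (coeffs (g i))" arbitrary: f g w r rule: less_induct)
  case less
  note fam = less.prems(1) and w = less.prems(2) and rel = less.prems(3)
    and r = less.prems(4,5)
  let ?n = "length vs"
  have fM: "f l \<in> M" if "l < ?n" for l using fam that by (simp add: family_def)
  \<comment> \<open>If some \<open>g l\<close> with \<open>l \<noteq> r\<close> is nonzero and
    \<open>strip\<close> fails, then \<open>g l\<close> and \<open>g r\<close> both have leading
    coefficients prime to \<open>p\<close>, and the one of larger degree can be reduced by the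
    other.\<close>
  consider
    (strip) i where "i < ?n" "g i \<noteq> 0" "p dvd lead_coeff (g i)"
  | (divide) i j where "i < ?n" "j < ?n" "i \<noteq> j" "g i \<noteq> 0" "g j \<noteq> 0" "degree (g j) \<le> degree (g i)"
      "\<not> p dvd lead_coeff (g j)"
  | (single) "\<And>l. l < ?n \<Longrightarrow> l \<noteq> r \<Longrightarrow> g l = 0"
  proof -
    have "g r \<noteq> 0" using r by auto
    then show ?thesis using r(1) that by (metis nle_le)
  qed
  then show ?case
  proof cases
    case strip
    obtain c where c: "lead_coeff (g i) = p * c" using strip(3) by (rule dvdE)
    \<comment> \<open>\<open>[:p:] * t\<close> is the leading term of \<open>g i\<close>. Its
      contribution moves to the left-hand side, where it changes \<open>w\<close> by an element of
      \<open>M\<close>; no coefficient changes modulo \<open>p\<close>.\<close>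
    define t where "t = monom c (degree (g i))"
    define x where "x = g i - [:p:] * t"
    have "length (coeffs x) < length (coeffs (g i))"
      unfolding x_def
      by (rule length_coeffs_diff_less) (use strip c in \<open>auto simp: t_def smult_monom degree_monom_le\<close>)
    then have m: "(\<Sum>l<?n. length (coeffs ((g(i := x)) l))) < (\<Sum>l<?n. length (coeffs (g l)))"
      using strip(1) by (intro sum_change_one_less)
    show ?thesis
    proof (rule less.hyps[OF m fam, where r = r])
      show "(\<lambda>v. w v - t * f i v) \<in> M" using diff_mem[OF w smult_mem[OF fM[OF strip(1)]]] .
      show "[:p:] * (w v - t * f i v) = (\<Sum>l<?n. (g(i := x)) l * f l v)" for v
        by (subst sum_change_one[OF strip(1), where H = "\<lambda>l. g l * f l v"])
          (simp_all add: rel[symmetric] x_def algebra_simps)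
      have "[:p:] dvd g i" if "[:p:] dvd x"
        using dvd_add[OF that dvd_triv_left[of "[:p:]" t]] by (simp add: x_def)
      then show "\<not> [:p:] dvd (g(i := x)) r" using r by auto
    qed (fact r)
  next
    case divide
    obtain u where "p dvd lead_coeff (g i) - u * lead_coeff (g j)"
      using irreducible_poly_solve_mod[OF irr divide(7)] by blast
    then obtain c where c: "lead_coeff (g i) - u * lead_coeff (g j) = p * c" by (rule dvdE)
    \<comment> \<open>One Euclidean step modulo \<open>p\<close>: \<open>q * g j\<close> matches the
      leading term of \<open>g i\<close> up to \<open>[:p:] * t\<close>. Subtracting it from
      \<open>g i\<close> is compensated by adding \<open>q * f i\<close> to
      \<open>f j\<close>.\<close>
    define q where "q = monom u (degree (g i) - degree (g j))"
    define t where "t = monom c (degree (g i))"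
    define x where "x = g i - (q * g j + [:p:] * t)"
    define f' where "f' = f(j := \<lambda>v. f j v + q * f i v)"
    have dq: "degree (q * g j) \<le> degree (g i)"
      using degree_mult_le[of q "g j"] degree_monom_le[of u "degree (g i) - degree (g j)"] divide(6)
      by (simp add: q_def)
    have cq: "coeff (q * g j) (degree (g i)) = u * lead_coeff (g j)"
      using divide(6) by (simp add: q_def coeff_monom_mult)
    have "length (coeffs x) < length (coeffs (g i))"
      unfolding x_def
    proof (rule length_coeffs_diff_less)
      show "degree (q * g j + [:p:] * t) \<le> degree (g i)"
        using dq by (intro degree_add_le) (auto simp: t_def smult_monom degree_monom_le)
      show "coeff (q * g j + [:p:] * t) (degree (g i)) = lead_coeff (g i)"
        using cq c by (simp add: t_def algebra_simps)
    qed (fact divide)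
    then have m: "(\<Sum>l<?n. length (coeffs ((g(i := x)) l))) < (\<Sum>l<?n. length (coeffs (g l)))"
      using divide(1) by (intro sum_change_one_less)
    have fam': "family f'"
      unfolding f'_def by (intro family_upd fam add_mem smult_mem fM divide)
    \<comment> \<open>These are the coefficients of the new row \<open>j\<close> in the old family.
      The entry 1 at \<open>j\<close> leaves the determinant unchanged.\<close>
    define d where "d l = (if l = j then 1 else if l = i then q else 0)" for l
    have "1 * family_det vs f' = d j * family_det vs f"
      unfolding f'_def
    proof (rule family_det_replace[OF divide(2)])
      fix k
      let ?H = "\<lambda>l. d l * f l (vs ! k)"
      have "(\<Sum>l<?n. ?H l) = (\<Sum>l<?n. if l = i then q * f i (vs ! k) else 0)
          + (?H j - (if j = i then q * f i (vs ! k) else 0))"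
        by (rule sum_change_one[OF divide(2)]) (auto simp: d_def)
      then show "1 * (f j (vs ! k) + q * f i (vs ! k)) = (\<Sum>l<?n. ?H l)"
        using divide by (simp add: d_def)
    qed
    then have det: "family_det vs f' = family_det vs f" by (simp add: d_def)
    show ?thesis
      unfolding det[symmetric]
    proof (rule less.hyps[OF m fam', where r = j])
      show "(\<lambda>v. w v - t * f i v) \<in> M" using diff_mem[OF w smult_mem[OF fM[OF divide(1)]]] .
      show "[:p:] * (w v - t * f i v) = (\<Sum>l<?n. (g(i := x)) l * f' l v)" for v
      proof -
        have "(\<Sum>l<?n. (g(i := x)) l * f' l v) = (\<Sum>l<?n. (g(i := x)) l * f l v)
            + ((g(i := x)) j * f' j v - (g(i := x)) j * f j v)"
          by (rule sum_change_one[OF divide(2)]) (simp add: f'_def)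
        also have "(\<Sum>l<?n. (g(i := x)) l * f l v) = [:p:] * w v + (x * f i v - g i * f i v)"
          by (subst sum_change_one[OF divide(1), where H = "\<lambda>l. g l * f l v"]) (simp_all add: rel[symmetric])
        finally show ?thesis using divide(3) by (simp add: x_def f'_def algebra_simps)
      qed
      \<comment> \<open>The index passes from \<open>r\<close> to \<open>j\<close>, because
        \<open>r\<close> may equal \<open>i\<close> and \<open>x\<close> may be divisible by
        \<open>p\<close>.\<close>
      show "\<not> [:p:] dvd (g(i := x)) j"
        using divide(3,7) by (auto simp: const_poly_dvd_iff)
    qed (fact divide)
  next
    case single
    have "(\<Sum>l<?n. g l * f l v) = g r * f r v" for v
    proof -
      have "(\<Sum>l<?n. g l * f l v) = (\<Sum>l<?n. if l = r then g r * f r v else 0)"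
        by (rule sum.cong) (auto simp: single)
      then show ?thesis using r by simp
    qed
    \<comment> \<open>Only one term is left, so saturation applies to \<open>f r\<close>
      itself.\<close>
    then have "g r * f r v = [:p:] * w v" for v using rel by metis
    moreover have "prime_elem [:p:]"
      using irr by (intro lift_prime_elem_poly field_poly_irreducible_imp_prime)
    ultimately obtain m where m: "m \<in> M" "\<And>v. f r v = [:p:] * m v"
      using divide_mem[of "[:p:]" "g r" "f r" w] r fM w by blast
    define d where "d l = (if l = r then 1 else 0 :: 'k poly poly)" for l
    have "[:p:] * family_det vs (f(r := m)) = d r * family_det vs f"
    proof (rule family_det_replace[OF r(1)])
      fix k
      have "(\<Sum>l<?n. d l * f l (vs ! k)) = (\<Sum>l<?n. if l = r then f r (vs ! k) else 0)"
        by (rule sum.cong) (auto simp: d_def)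
      then show "[:p:] * m (vs ! k) = (\<Sum>l<?n. d l * f l (vs ! k))"
        using r m(2) by simp
    qed
    then have "[:p:] * family_det vs (f(r := m)) = family_det vs f" by (simp add: d_def)
    then show ?thesis using family_upd[OF fam m(1)] by auto
  qed
qed

lemma family_det_linear:
  assumes "i < length vs"
  shows "family_det vs (f(i := \<lambda>v. a * w v - b * f i v))
    = a * family_det vs (f(i := w)) - b * family_det vs f"
proof -
  have "family_det vs (f(i := \<lambda>v. a * w v - b * f i v))
      = a * family_det vs (f(i := w)) - b * family_det vs (f(i := f i))"
    unfolding family_det_laplace[OF assms]
    by (simp add: sum_distrib_left sum_subtractf left_diff_distrib mult.assoc)
  then show ?thesis by simp
qed

text \<open>Cramer's rule expresses \<open>family_det vs f * w\<close> with the determinants of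
  \<open>f(i := w)\<close> as coefficients. Minimality of the degree in y makes
  \<open>family_det vs f\<close> divide these up to a factor in k[x], and it can then be
  cancelled.\<close>

lemma combination_of_multiple:
  assumes fam: "family f" and nz: "family_det vs f \<noteq> 0"
    and min: "\<And>f'. family f' \<Longrightarrow> family_det vs f' \<noteq> 0 \<Longrightarrow>
      degree (family_det vs f) \<le> degree (family_det vs f')"
    and w: "w \<in> M"
  shows "\<exists>a. a \<noteq> 0 \<and> combination f (\<lambda>v. [:a:] * w v)"
proof -
  let ?n = "length vs" and ?h = "family_det vs f"
  have "\<exists>c. c \<noteq> 0 \<and> ?h dvd [:c:] * family_det vs (f(i := w))" if i: "i < ?n" for i
  proof -
    let ?d = "family_det vs (f(i := w))"
    obtain q r where qr: "pseudo_divmod ?d ?h = (q, r)" by fastforce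
    define c where "c = lead_coeff ?h ^ (Suc (degree ?d) - degree ?h)"
    have eq: "Polynomial.smult c ?d = ?h * q + r" and r: "r = 0 \<or> degree r < degree ?h"
      using pseudo_divmod[OF nz qr] by (simp_all add: c_def)
    \<comment> \<open>The remainder \<open>r\<close> is the determinant of the family with
      \<open>?w\<close> in place \<open>i\<close>. Its degree would be too small if it were
      nonzero.\<close>
    let ?w = "\<lambda>v. [:c:] * w v - q * f i v"
    have "family_det vs (f(i := ?w)) = r"
      unfolding family_det_linear[OF i] using eq by (simp add: mult.commute)
    moreover have "family (f(i := ?w))"
      using fam i by (intro family_upd fam diff_mem smult_mem w) (simp add: family_def)
    ultimately have "r = 0" using min r by (metis not_le)
    moreover have "c \<noteq> 0" using nz by (simp add: c_def)
    ultimately show ?thesis using eq by (intro exI[of _ c]) simp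
  qed
  then obtain c where c: "\<And>i. i < ?n \<Longrightarrow> c i \<noteq> 0"
    and dvd: "\<And>i. i < ?n \<Longrightarrow> ?h dvd [:c i:] * family_det vs (f(i := w))"
    by metis
  \<comment> \<open>A single multiplier that serves all indices.\<close>
  define a where "a = prod c {..<?n}"
  have "a \<noteq> 0" using c by (simp add: a_def)
  have "?h dvd [:a:] * family_det vs (f(i := w))" if i: "i < ?n" for i
  proof -
    have "a = prod c ({..<?n} - {i}) * c i"
      using i by (simp add: a_def prod.remove[of "{..<?n}" i] mult.commute)
    then have "[:a:] * family_det vs (f(i := w))
        = [:prod c ({..<?n} - {i}):] * ([:c i:] * family_det vs (f(i := w)))"
      by (simp add: mult.commute)
    then show ?thesis using dvd_mult[OF dvd[OF i]] by metis
  qed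
  then obtain q where q: "\<And>i. i < ?n \<Longrightarrow> [:a:] * family_det vs (f(i := w)) = ?h * q i"
    unfolding dvd_def by metis
  have "[:a:] * w (vs ! j) = (\<Sum>i<?n. q i * f i (vs ! j))" if j: "j < ?n" for j
  proof -
    have "?h * ([:a:] * w (vs ! j)) = [:a:] * (?h * w (vs ! j))" by (rule mult.left_commute)
    also have "?h * w (vs ! j) = (\<Sum>i<?n. family_det vs (f(i := w)) * f i (vs ! j))"
      by (rule family_det_cramer[OF j])
    also have "[:a:] * \<dots> = (\<Sum>i<?n. ([:a:] * family_det vs (f(i := w))) * f i (vs ! j))"
      by (simp only: sum_distrib_left mult.assoc)
    also have "\<dots> = ?h * (\<Sum>i<?n. q i * f i (vs ! j))"
      unfolding sum_distrib_left
      by (rule sum.cong) (simp_all add: q mult.assoc del: mult_pCons_left)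
    finally show ?thesis by (rule mult_left_cancel[OF nz, THEN iffD1])
  qed
  then have "[:a:] * w v = (\<Sum>i<?n. q i * f i v)" for v
    by (rule eq_of_eq_on_coordinates[OF smult_mem[OF w] combination_mem[OF fam]])
  then show ?thesis using \<open>a \<noteq> 0\<close> by (auto simp: combination_def)
qed

lemma combination_smult:
  assumes "combination f w"
  shows "combination f (\<lambda>v. c * w v)"
proof -
  obtain g where "\<And>v. w v = (\<Sum>i<length vs. g i * f i v)"
    using assms unfolding combination_def by blast
  then have "c * w v = (\<Sum>i<length vs. (c * g i) * f i v)" for v
    by (simp add: sum_distrib_left mult.assoc)
  then show ?thesis unfolding combination_def by (intro exI allI)
qed

lemma ex_basis:
  "\<exists>f. family f \<and> family_det vs f \<noteq> 0 \<and> (\<forall>w\<in>M. combination f w)"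
proof -
  define P where "P f \<longleftrightarrow> family f \<and> family_det vs f \<noteq> 0" for f
  have "\<exists>f. P f" using nondegenerate by (auto simp: P_def family_def)
  then obtain f1 where f1: "P f1"
    and min1: "\<And>f. P f \<Longrightarrow> degree (family_det vs f1) \<le> degree (family_det vs f)"
    using ex_has_least_nat[of P _ "\<lambda>f. degree (family_det vs f)"] by blast
  define Q where "Q f \<longleftrightarrow> P f \<and> degree (family_det vs f) = degree (family_det vs f1)" for f
  have "Q f1" using f1 by (simp add: Q_def)
  then obtain f where Qf: "Q f" and min: "\<And>f'. Q f' \<Longrightarrow>
      degree (lead_coeff (family_det vs f)) \<le> degree (lead_coeff (family_det vs f'))"
    using ex_has_least_nat[of Q _ "\<lambda>f. degree (lead_coeff (family_det vs f))"] by blast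
  have fam: "family f" and nz: "family_det vs f \<noteq> 0" using Qf by (auto simp: Q_def P_def)
  have "combination f w0" if w0: "w0 \<in> M" for w0
  proof (rule ccontr)
    assume nw0: "\<not> combination f w0"
    \<comment> \<open>The elements of k[x] that carry some element of \<open>M\<close> outside the
      span into it. One of least degree turns out to be irreducible.\<close>
    define B where "B a \<longleftrightarrow> a \<noteq> 0 \<and> (\<exists>w\<in>M. \<not> combination f w \<and> combination f (\<lambda>v. [:a:] * w v))"
      for a
    have "\<exists>a. B a"
      using combination_of_multiple[OF fam nz _ w0] min1 Qf w0 nw0
      by (fastforce simp: B_def Q_def P_def)
    then obtain p where p: "B p" and minp: "\<And>a. B a \<Longrightarrow> degree p \<le> degree a"
      using ex_has_least_nat[of B _ degree] by blast
    then obtain w where w: "w \<in> M" and nw: "\<not> combination f w"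
      and pw: "combination f (\<lambda>v. [:p:] * w v)" and p0: "p \<noteq> 0" by (auto simp: B_def)
    have nu: "\<not> p dvd 1"
    proof
      assume "p dvd 1"
      then obtain p' where "p * p' = 1" by (metis dvdE)
      then have "w = (\<lambda>v. [:p':] * ([:p:] * w v))" by (simp add: fun_eq_iff)
      then show False using combination_smult[OF pw, of "[:p':]"] nw by simp
    qed
    have irr: "irreducible p"
    proof (rule irreducibleI[OF p0 nu])
      fix b c assume bc: "p = b * c"
      then have b: "b \<noteq> 0" and c: "c \<noteq> 0" using p0 by auto
      have deg: "degree p = degree b + degree c" using b c by (simp add: bc degree_mult_eq)
      show "b dvd 1 \<or> c dvd 1"
      \<comment> \<open>Either \<open>c\<close> already carries \<open>w\<close> into the span, or
        \<open>[:c:] * w\<close> lies outside and \<open>b\<close> carries it in. Minimality of the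
        degree of \<open>p\<close> makes the other factor constant.\<close>
      proof (cases "combination f (\<lambda>v. [:c:] * w v)")
        case True
        then have "B c" using c w nw by (auto simp: B_def)
        then show ?thesis using minp deg b by (fastforce simp: is_unit_iff_degree)
      next
        case False
        have "[:p:] * w v = [:b:] * ([:c:] * w v)" for v by (simp add: bc mult.commute)
        then have "combination f (\<lambda>v. [:b:] * ([:c:] * w v))" using pw by (simp only:)
        then have "B b" using b False smult_mem[OF w, of "[:c:]"] unfolding B_def by blast
        then show ?thesis using minp deg c by (fastforce simp: is_unit_iff_degree)
      qed
    qed
    obtain g where g: "\<And>v. [:p:] * w v = (\<Sum>i<length vs. g i * f i v)"
      using pw unfolding combination_def by blast
    \<comment> \<open>Otherwise \<open>p\<close> cancels from the relation and \<open>w\<close> is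
      itself a combination.\<close>
    have "\<exists>i<length vs. \<not> [:p:] dvd g i"
    proof (rule ccontr)
      assume "\<not> (\<exists>i<length vs. \<not> [:p:] dvd g i)"
      then obtain g' where g': "\<And>i. i < length vs \<Longrightarrow> g i = [:p:] * g' i"
        unfolding dvd_def by metis
      have "[:p:] * w v = [:p:] * (\<Sum>i<length vs. g' i * f i v)" for v
        unfolding g sum_distrib_left by (rule sum.cong) (simp_all add: g')
      moreover have "[:p:] \<noteq> 0" using p0 by simp
      ultimately have "w v = (\<Sum>i<length vs. g' i * f i v)" for v
        using mult_left_cancel by blast
      then show False using nw by (auto simp: combination_def)
    qed
    then obtain i0 where "i0 < length vs" "\<not> [:p:] dvd g i0" by blast
    then obtain f' where f': "family f'" "[:p:] * family_det vs f' = family_det vs f"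
      using divide_family_det[OF irr fam w g] by blast
    have nz': "family_det vs f' \<noteq> 0" using f'(2) nz by auto
    \<comment> \<open>As \<open>[:p:]\<close> is constant in y, dividing by it keeps the degree in y
      and removes a factor \<open>p\<close> from the leading coefficient. Minimality then makes
      \<open>p\<close> constant, hence a unit.\<close>
    have dl: "degree (family_det vs f) = degree (family_det vs f')"
      "lead_coeff (family_det vs f) = p * lead_coeff (family_det vs f')"
      using p0 by (simp_all add: f'(2)[symmetric] lead_coeff_smult)
    then have "Q f'" using Qf f' nz' by (simp add: Q_def P_def)
    from min[OF this] have "degree p = 0"
      using nz' p0 by (simp add: dl(2) degree_mult_eq)
    then show False using nu p0 by (simp add: is_unit_iff_degree)
  qed
  then show ?thesis using fam nz by blast
qed

end

section \<open>Splines form a saturated module\<close>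

text \<open>Take a smallest set of coordinates that detects nonzero elements. Dropping
  \<open>v\<close> must lose some element of \<open>M\<close>, which is then nonzero at
  \<open>v\<close> and zero at the other chosen coordinates. These elements form a diagonal matrix
  with nonzero diagonal.\<close>

lemma ex_coordinates:
  fixes M :: "('v \<Rightarrow> 'a::idom) set"
  assumes "finite V" "\<And>m v. m \<in> M \<Longrightarrow> v \<notin> V \<Longrightarrow> m v = 0"
  shows "\<exists>vs. (\<forall>m\<in>M. (\<forall>j<length vs. m (vs ! j) = 0) \<longrightarrow> (\<forall>v. m v = 0)) \<and>
    (\<exists>f. (\<forall>i<length vs. f i \<in> M) \<and> family_det vs f \<noteq> 0)"
proof -
  define P where "P S \<longleftrightarrow> finite S \<and> (\<forall>m\<in>M. (\<forall>v\<in>S. m v = 0) \<longrightarrow> (\<forall>v. m v = 0))" for S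
  have "P V" using assms by (auto simp: P_def)
  then obtain S where S: "P S" and min: "\<And>S'. P S' \<Longrightarrow> card S \<le> card S'"
    using ex_has_least_nat[of P V card] by blast
  have "\<exists>m\<in>M. (\<forall>u\<in>S - {v}. m u = 0) \<and> m v \<noteq> 0" if v: "v \<in> S" for v
  proof -
    have "card (S - {v}) < card S" using S v by (intro card_Diff1_less) (auto simp: P_def)
    then have "\<not> P (S - {v})" using min by (meson not_le)
    then show ?thesis using S unfolding P_def by (metis Diff_iff finite_Diff singletonD)
  qed
  then obtain h where h: "\<And>v. v \<in> S \<Longrightarrow> h v \<in> M" "\<And>v. v \<in> S \<Longrightarrow> h v v \<noteq> 0"
    "\<And>u v. v \<in> S \<Longrightarrow> u \<in> S - {v} \<Longrightarrow> h v u = 0"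
    by metis
  have "finite S" using S by (simp add: P_def)
  then obtain vs where vs: "set vs = S" "distinct vs"
    using finite_distinct_list by blast
  have mem: "vs ! i \<in> S" if "i < length vs" for i using vs that by auto
  have "h (vs ! i) (vs ! j) = 0" if "i < length vs" "j < length vs" "i \<noteq> j" for i j
    using that vs by (intro h(3)) (auto simp: nth_eq_iff_index_eq)
  then have "family_det vs (\<lambda>i. h (vs ! i)) = (\<Prod>i<length vs. h (vs ! i) (vs ! i))"
    by (intro family_det_diagonal vs)
  then have "family_det vs (\<lambda>i. h (vs ! i)) \<noteq> 0" using h(2)[OF mem] by simp
  moreover have "\<forall>i<length vs. h (vs ! i) \<in> M" using h(1)[OF mem] by simp
  moreover have "\<forall>m\<in>M. (\<forall>j<length vs. m (vs ! j) = 0) \<longrightarrow> (\<forall>v. m v = 0)"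
    using S vs by (metis P_def in_set_conv_nth)
  ultimately show ?thesis by (intro exI[of _ vs]) auto
qed

text \<open>Write \<open>p * d = a * b\<close>. If \<open>p\<close> divides \<open>b\<close>, cancel
  it. Otherwise \<open>p\<close> divides \<open>a\<close>, and cancelling in
  \<open>g * d = a * c\<close> shows that \<open>p\<close> divides \<open>g * b\<close>, which
  primality excludes.\<close>

lemma dvd_of_dvd_prime_mult:
  fixes a d g p :: "'a::idom"
  assumes p: "prime_elem p" and g: "\<not> p dvd g" and ap: "a dvd p * d" and ag: "a dvd g * d"
  shows "a dvd d"
proof (cases "d = 0")
  case False
  have p0: "p \<noteq> 0" using p by auto
  obtain b where b: "p * d = a * b" using ap by (rule dvdE)
  have "p dvd b"
  proof (rule ccontr)
    assume nb: "\<not> p dvd b"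
    have "p dvd a" using b p nb by (metis dvd_triv_left prime_elem_dvd_mult_iff)
    then obtain a' where a': "a = p * a'" by (rule dvdE)
    then have d: "d = a' * b" using b p0 by (simp add: mult.assoc)
    obtain c where "g * d = a * c" using ag by (rule dvdE)
    then have "a' * (g * b) = a' * (p * c)" by (simp add: d a' mult_ac)
    then have "g * b = p * c" using d False by auto
    then show False using g nb p by (metis dvd_triv_left prime_elem_dvd_mult_iff)
  qed
  then obtain b' where "b = p * b'" by (rule dvdE)
  then have "d = a * b'" using b p0 by (simp add: mult.left_commute)
  then show ?thesis by simp
qed simp

text \<open>Extending by \<open>0\<close> instead of \<open>undefined\<close> makes the splines closed under pointwise operations on
  the whole type.\<close>

definition zero_extended_splines ::
    "('v, 'e, 'z) ugraph_scheme \<Rightarrow> ('e \<Rightarrow> 'a::comm_ring_1) \<Rightarrow> ('v \<Rightarrow> 'a) set" where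
  "zero_extended_splines G \<alpha> = {s. (\<forall>v. v \<notin> verts G \<longrightarrow> s v = 0) \<and>
     (\<forall>e\<in>edges G. \<forall>u v. ends G e = {u, v} \<longrightarrow> \<alpha> e dvd s u - s v)}"

lemma saturated_module_splines:
  fixes \<alpha> :: "'e \<Rightarrow> 'k::field poly poly"
  assumes "finite (verts G)"
  shows "\<exists>vs. saturated_module (zero_extended_splines G \<alpha>) vs"
proof -
  let ?M = "zero_extended_splines G \<alpha>"
  obtain vs where vs: "\<forall>m\<in>?M. (\<forall>j<length vs. m (vs ! j) = 0) \<longrightarrow> (\<forall>v. m v = 0)"
    "\<exists>f. (\<forall>i<length vs. f i \<in> ?M) \<and> family_det vs f \<noteq> 0"
    using ex_coordinates[OF assms, of ?M] by (auto simp: zero_extended_splines_def)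
  have "saturated_module ?M vs"
  proof
    show "(\<lambda>v. 0) \<in> ?M" by (simp add: zero_extended_splines_def)
    show "(\<lambda>v. m v + m' v) \<in> ?M" if "m \<in> ?M" "m' \<in> ?M" for m m'
    proof -
      have "m u + m' u - (m v + m' v) = (m u - m v) + (m' u - m' v)" for u v by simp
      then show ?thesis
        using that unfolding zero_extended_splines_def mem_Collect_eq by (metis add_0 dvd_add)
    qed
    show "(\<lambda>v. c * m v) \<in> ?M" if "m \<in> ?M" for m c
      using that
      by (auto simp: zero_extended_splines_def right_diff_distrib[symmetric] simp del: mult_pCons_left)
    show "m v = 0" if "m \<in> ?M" "\<And>j. j < length vs \<Longrightarrow> m (vs ! j) = 0" for m v
      using vs(1) that by blast
    show "\<exists>n\<in>?M. \<forall>v. m v = p * n v"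
      if p: "prime_elem p" and g: "\<not> p dvd g" and m: "m \<in> ?M" and m': "m' \<in> ?M"
        and eq: "\<And>v. g * m v = p * m' v" for p g m m'
    proof -
      have p0: "p \<noteq> 0" using p by auto
      \<comment> \<open>Primality gives the quotient \<open>n\<close> pointwise. Both
        \<open>p * n\<close> and \<open>g * n\<close> are splines, so each edge condition for
        \<open>n\<close> reduces to divisibility by the single generator
        \<open>\<alpha> e\<close>.\<close>
      have "p dvd m v" for v
        using eq[of v] p g by (metis dvd_triv_left prime_elem_dvd_mult_iff)
      then obtain n where n: "\<And>v. m v = p * n v" unfolding dvd_def by metis
      have gn: "g * n v = m' v" for v
        using eq[of v] p0 by (simp add: n mult.left_commute)
      have "\<alpha> e dvd n u - n v" if "e \<in> edges G" "ends G e = {u, v}" for e u v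
      proof (rule dvd_of_dvd_prime_mult[OF p g])
        show "\<alpha> e dvd p * (n u - n v)"
          using m that by (auto simp: zero_extended_splines_def right_diff_distrib n)
        show "\<alpha> e dvd g * (n u - n v)"
          using m' that by (auto simp: zero_extended_splines_def right_diff_distrib gn)
      qed
      moreover have "n v = 0" if "v \<notin> verts G" for v
        using m that p0 n[of v] by (auto simp: zero_extended_splines_def)
      ultimately have "n \<in> ?M" by (auto simp: zero_extended_splines_def)
      then show ?thesis using n by blast
    qed
  qed (fact vs(2))
  then show ?thesis ..
qed

section \<open>Transfer of the basis to the spline ring\<close>

lemma label_principal:
  assumes "principalideal J (class_ring :: 'a::comm_ring_1 ring)"
  shows "\<exists>a. J = {x. a dvd x}"
proof -
  obtain a where "J = Idl\<^bsub>class_ring\<^esub> {a}"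
    using principalideal.generate[OF assms] by auto
  also have "\<dots> = PIdl\<^bsub>class_ring\<^esub> a"
    by (rule cring.cgenideal_eq_genideal[OF class_cring.is_cring, symmetric]) simp
  also have "\<dots> = {x. a dvd x}"
    by (auto simp: cgenideal_def dvd_def mult.commute)
  finally show ?thesis by blast
qed

lemma restrict_mem_spline_set_iff:
  assumes "finite_graph G" "\<And>e. e \<in> edges G \<Longrightarrow> label G e = {x. \<alpha> e dvd x}"
    and "\<And>v. v \<notin> verts G \<Longrightarrow> s v = 0"
  shows "restrict s (verts G) \<in> spline_set class_ring G \<longleftrightarrow> s \<in> zero_extended_splines G \<alpha>"
proof -
  have "u \<in> verts G" "v \<in> verts G" if "e \<in> edges G" "ends G e = {u, v}" for e u v
    using assms(1) that by (auto simp: finite_graph_def doubleton_eq_iff)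
  then show ?thesis
    using assms(2,3) by (auto simp: spline_set_def zero_extended_splines_def class_ring_simps)
qed

theorem corollary3:
  fixes G :: "('v, 'e, 'k::field poly poly) labeled_graph"
    and I :: "'i set" and f :: "'i \<Rightarrow> 'k poly poly"
  assumes "edge_labeled_graph kxy G"
    and "\<And>e. e \<in> edges G \<Longrightarrow> principalideal (label G e) kxy"
    and "(\<Union>i\<in>I. distinguished_open kxy (f i)) = Spec kxy"
    and "\<And>i. i \<in> I \<Longrightarrow>
      trivial_graph (localization_at kxy (f i)) (localize_graph kxy (f i) G) \<or>
      fully_determined_by_cycles (localization_at kxy (f i)) (localize_graph kxy (f i) G)"
  shows "free_module kxy (spline_ring kxy G)"
proof -
  let ?V = "verts G" and ?N = "spline_ring kxy G"
  have fin: "finite_graph G" using assms(1) by (simp add: edge_labeled_graph_def)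
  obtain \<alpha> where \<alpha>: "\<And>e. e \<in> edges G \<Longrightarrow> label G e = {x. \<alpha> e dvd x}"
    using label_principal[OF assms(2)] by metis
  define M where "M = zero_extended_splines G \<alpha>"
  obtain vs where "saturated_module M vs"
    using saturated_module_splines[of G \<alpha>] fin by (auto simp: M_def finite_graph_def)
  then interpret S: saturated_module M vs .
  let ?n = "length vs"
  obtain b where b: "S.family b" and det: "family_det vs b \<noteq> 0"
    and gen: "\<And>w. w \<in> M \<Longrightarrow> S.combination b w"
    using S.ex_basis by blast
  interpret N: Module.module kxy ?N
    using class_cring.algebra_spline_ring[OF assms(1)] by (rule algebra.axioms(1))
  have carrierN: "carrier ?N = spline_set kxy G" by (simp add: spline_ring_def)
  have off: "m v = 0" if "m \<in> M" "v \<notin> ?V" for m v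
    using that by (simp add: M_def zero_extended_splines_def)
  have bM: "b i \<in> M" if "i < ?n" for i using b that by (simp add: S.family_def)
  \<comment> \<open>Elements of the spline ring are \<open>undefined\<close> off the vertices,
    whereas elements of \<open>M\<close> are 0 there.\<close>
  define h where "h i = restrict (b i) ?V" for i
  have hN: "h i \<in> carrier ?N" if "i < ?n" for i
    unfolding h_def carrierN
    using restrict_mem_spline_set_iff[OF fin \<alpha>] off[OF bM[OF that]] bM[OF that] by (simp add: M_def)
  have b_eq_h: "b i v = (if v \<in> ?V then h i v else 0)" if "i < ?n" for i v
    using off[OF bM[OF that]] by (simp add: h_def)
  \<comment> \<open>Linear dependence and span refer to sets, so the members must be distinct. Two
    equal members would give a relation with coefficients 1 and -1, forcing the determinant to
    vanish.\<close>
  have inj: "inj_on h {..<?n}"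
  proof (rule inj_onI, rule ccontr)
    fix i j assume ij: "i \<in> {..<?n}" "j \<in> {..<?n}" "h i = h j" "i \<noteq> j"
    then have "b i = b j" by (auto simp: fun_eq_iff b_eq_h)
    define g where "g l = (if l = j then 1 else if l = i then -1 else 0 :: 'k poly poly)" for l
    have "(\<Sum>l<?n. g l * b l v) = (\<Sum>l<?n. if l = i then - b i v else 0)
        + (g j * b j v - (if j = i then - b i v else 0))" for v
      using ij by (intro sum_change_one) (auto simp: g_def)
    then have "(\<Sum>l<?n. g l * b l v) = 0" for v
      using ij \<open>b i = b j\<close> by (simp add: g_def)
    then have "g j * family_det vs b = 0"
      using ij by (intro family_det_eq_0_of_relation) auto
    then show False using det by (simp add: g_def)
  qed
  have lincomb: "N.lincomb a A = (\<lambda>v\<in>?V. \<Sum>s\<in>A. a s * s v)"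
    if "finite A" "A \<subseteq> carrier ?N" for a A
    using that
  proof (induction A)
    case empty
    show ?case unfolding N.lincomb_def N.finsum_empty by (simp add: spline_ring_def)
  next
    case (insert s A)
    have "N.lincomb a (insert s A) = a s \<odot>\<^bsub>?N\<^esub> s \<oplus>\<^bsub>?N\<^esub> N.lincomb a A"
      unfolding N.lincomb_def using insert by (intro N.finsum_insert) auto
    then show ?case
      using insert by (auto simp: spline_ring_def fun_eq_iff)
  qed
  have "\<not> N.lin_dep (h ` {..<?n})"
  proof
    assume "N.lin_dep (h ` {..<?n})"
    then obtain A a s where A: "finite A" "A \<subseteq> h ` {..<?n}" "N.lincomb a A = \<zero>\<^bsub>?N\<^esub>" "s \<in> A"
      and nz: "a s \<noteq> 0"
      unfolding N.lin_dep_def by auto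
    \<comment> \<open>The relation on the subset \<open>A\<close> is extended by 0 to the whole
      family.\<close>
    define g where "g l = (if h l \<in> A then a (h l) else 0)" for l
    have "(\<Sum>l<?n. g l * b l v) = 0" for v
    proof (cases "v \<in> ?V")
      case True
      have "A \<subseteq> carrier ?N" using A(2) hN by auto
      then have "(\<lambda>v\<in>?V. \<Sum>s\<in>A. a s * s v) = (\<lambda>v\<in>?V. 0)"
        using A(3) unfolding lincomb[OF A(1) \<open>A \<subseteq> carrier ?N\<close>] by (simp add: spline_ring_def)
      from fun_cong[OF this, of v] have "(\<Sum>s\<in>A. a s * s v) = 0" using True by simp
      moreover have "(\<Sum>s\<in>A. a s * s v) = (\<Sum>s\<in>h ` {..<?n}. (if s \<in> A then a s else 0) * s v)"
        using A by (intro sum.mono_neutral_cong_left) auto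
      moreover have "\<dots> = (\<Sum>l<?n. g l * b l v)"
        using True by (simp add: sum.reindex[OF inj] g_def b_eq_h)
      ultimately show ?thesis by simp
    qed (simp add: b_eq_h)
    moreover obtain i where i: "i < ?n" "s = h i" using A by auto
    ultimately have "g i * family_det vs b = 0" by (intro family_det_eq_0_of_relation)
    then show False using det nz i A by (simp add: g_def)
  qed
  moreover have "N.span (h ` {..<?n}) = carrier ?N"
  proof (intro equalityI subsetI)
    fix s assume "s \<in> N.span (h ` {..<?n})"
    then show "s \<in> carrier ?N" using hN unfolding N.span_def by (auto intro!: N.lincomb_closed)
  next
    fix s assume s: "s \<in> carrier ?N"
    define m where "m v = (if v \<in> ?V then s v else 0)" for v
    have sm: "s = restrict m ?V"
      using s by (auto simp: carrierN spline_set_def m_def fun_eq_iff PiE_def extensional_def)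
    have "m \<in> M"
      using s restrict_mem_spline_set_iff[OF fin \<alpha>, of m] unfolding sm carrierN M_def
      by (simp add: m_def)
    then obtain g where g: "\<And>v. m v = (\<Sum>l<?n. g l * b l v)"
      using gen unfolding S.combination_def by metis
    \<comment> \<open>The coefficients are reindexed by the basis elements themselves, through the
      inverse of \<open>h\<close>.\<close>
    define a where "a s = g (the_inv_into {..<?n} h s)" for s
    have "h ` {..<?n} \<subseteq> carrier ?N" using hN by auto
    then have "N.lincomb a (h ` {..<?n}) = (\<lambda>v\<in>?V. \<Sum>s\<in>h ` {..<?n}. a s * s v)"
      by (intro lincomb) auto
    also have "\<dots> = s"
      unfolding sm g
      by (rule restrict_ext) (simp add: sum.reindex[OF inj] a_def the_inv_into_f_f[OF inj] b_eq_h)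
    finally show "s \<in> N.span (h ` {..<?n})" unfolding N.span_def by force
  qed
  moreover have "h ` {..<?n} \<subseteq> carrier ?N" using hN by auto
  ultimately show ?thesis unfolding free_module_def using N.module_axioms by blast
qed

end
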